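(* Let $X$ be a complete metric space. (1) If $X$ is noncompact and locally compact, then $\mathrm{K}(X)\approx \mathrm{Fin}(\mathrm{d}(X))$. (2) If $X$ is not locally compact, then: (a) if the local density of $X$ is not realized, then $\mathrm{K}(X)\approx \mathrm{Fin}(\mathrm{d}(X))\times \mathrm{Bdd}\bigl(\mathrm{Fin}(\mathrm{ld}(X))^{\mathbb N}\bigr)$; (b) if the local density of $X$ is realized, or the cardinal number $\mathrm{ld}(X)$ has uncountable cofinality, then $\mathrm{K}(X)\approx \mathrm{Fin}(\mathrm{d}(X))\times \mathrm{Fin}(\mathrm{ld}(X))^{\mathbb N}$.
   Context: $\mathrm{K}(X)$ is the family of compact subsets of $X$, partially ordered by inclusion. $\mathrm{d}(X)$ is the minimal cardinality of a dense subset of $X$. For a point $x\in X$, the local density $\mathrm{ld}(x)$ is the minimal density of a neighborhood of $x$; the local density of $X$ is $\mathrm{ld}(X):=\sup_{x\in X}\mathrm{ld}(x)$; it is realized if there is $x\in X$ with $\mathrm{ld}(x)=\mathrm{ld}(X)$. For a set $S$, $\mathrm{Fin}(S)$ is the set of finite subsets of $S$, ordered by inclusion; $\mathrm{Fin}(S)^{\mathbb N}$ is the set of functions $f\colon\mathbb N\to\mathrm{Fin}(S)$, ordered by $f\le g$ iff $f(n)\subseteq g(n)$ for all $n$. For an infinite cardinal $\kappa$, $\mathrm{Bdd}(\mathrm{Fin}(\kappa)^{\mathbb N}):=\bigcup_{\alpha<\kappa}\mathrm{Fin}(\alpha)^{\mathbb N}$ (union over ordinals $\alpha<\kappa$), with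 the order inherited from $\mathrm{Fin}(\kappa)^{\mathbb N}$. Products of partially ordered sets carry the coordinatewise order. For partially ordered sets $P,Q$, write $P\preceq Q$ if there is a monotone (order-preserving) map $\psi\colon P\to Q$ whose image is cofinal in $Q$ (every $q\in Q$ satisfies $q\le\psi(p)$ for some $p\in P$). $P\approx Q$ (cofinal equivalence) means $P\preceq Q$ and $Q\preceq P$. *)

theory Defs
  imports "HOL-Analysis.Analysis"
begin

unbundle cardinal_syntax

section \<open>Cofinal equivalence of partially ordered sets\<close>

text \<open>
  A partially ordered set is a set of elements of a type of class \<^class>\<open>order\<close>, with the
  order of the type. For sets this order is inclusion, and for functions and pairs it is the
  pointwise and the coordinatewise order.
\<close>

definition cofinal_below :: "'p::order set \<Rightarrow> 'q::order set \<Rightarrow> bool"  (infix "\<preceq>\<^sub>c" 50) where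
  "P \<preceq>\<^sub>c Q \<longleftrightarrow>
     (\<exists>\<psi>. \<psi> ` P \<subseteq> Q \<and> mono_on P \<psi> \<and> (\<forall>q\<in>Q. \<exists>p\<in>P. q \<le> \<psi> p))"

definition cofinally_equivalent :: "'p::order set \<Rightarrow> 'q::order set \<Rightarrow> bool"  (infix "\<approx>\<^sub>c" 50) where
  "P \<approx>\<^sub>c Q \<longleftrightarrow> P \<preceq>\<^sub>c Q \<and> Q \<preceq>\<^sub>c P"


section \<open>Cardinal invariants\<close>

text \<open>
  A cardinal is a well-order satisfying \<^const>\<open>Card_order\<close>, considered up to
  \<^const>\<open>ordIso\<close>. Minima of families of cardinals exist and are unique up to
  \<^const>\<open>ordIso\<close>; the choice operator picks a representative.
\<close>

definition least_cardinal :: "'b rel set \<Rightarrow> 'b rel" where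
  "least_cardinal R = (SOME r. r \<in> R \<and> (\<forall>s\<in>R. r \<le>o s))"

lemma least_cardinal:
  assumes "R \<noteq> {}" and "\<And>r. r \<in> R \<Longrightarrow> Card_order r"
  shows "least_cardinal R \<in> R" and "\<And>s. s \<in> R \<Longrightarrow> least_cardinal R \<le>o s"
proof -
  have "\<exists>r. r \<in> R \<and> (\<forall>s\<in>R. r \<le>o s)"
    using exists_minim_Card_order[of R] assms by blast
  then have *: "least_cardinal R \<in> R \<and> (\<forall>s\<in>R. least_cardinal R \<le>o s)"
    unfolding least_cardinal_def by (rule someI_ex)
  show "least_cardinal R \<in> R" and "\<And>s. s \<in> R \<Longrightarrow> least_cardinal R \<le>o s"
    using * by auto
qed

definition dens :: "'a::metric_space set \<Rightarrow> 'a rel" where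
  "dens N = least_cardinal {|D| | D. D \<subseteq> N \<and> N \<subseteq> closure D}"

lemma Card_order_dens: "Card_order (dens N)"
proof -
  have "dens N \<in> {|D| | D. D \<subseteq> N \<and> N \<subseteq> closure D}"
    unfolding dens_def
    by (rule least_cardinal(1)) (use closure_subset[of N] in \<open>auto simp: card_of_Card_order\<close>)
  then show ?thesis
    by (auto simp: card_of_Card_order)
qed

definition local_density_at :: "'a::metric_space set \<Rightarrow> 'a \<Rightarrow> 'a rel" where
  "local_density_at X x =
     least_cardinal {dens N | N. N \<subseteq> X \<and> x \<in> top_of_set X interior_of N}"

text \<open>
  The supremum is the least cardinal that is an upper bound. Cardinals on the type of the points
  suffice, because the cardinality of \<open>X\<close> is an upper bound.
\<close>

definition local_density :: "'a::metric_space set \<Rightarrow> 'a rel" where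
  "local_density X =
     least_cardinal {r. Card_order r \<and> (\<forall>x\<in>X. local_density_at X x \<le>o r)}"

definition local_density_realized :: "'a::metric_space set \<Rightarrow> bool" where
  "local_density_realized X \<longleftrightarrow> (\<exists>x\<in>X. local_density_at X x =o local_density X)"

lemma local_density_at:
  assumes "x \<in> X"
  shows "local_density_at X x \<in> {dens N | N. N \<subseteq> X \<and> x \<in> top_of_set X interior_of N}"
    and "\<And>N. N \<subseteq> X \<Longrightarrow> x \<in> top_of_set X interior_of N \<Longrightarrow> local_density_at X x \<le>o dens N"
proof -
  let ?R = "{dens N | N. N \<subseteq> X \<and> x \<in> top_of_set X interior_of N}"
  have "x \<in> top_of_set X interior_of X"
    using assms interior_of_topspace[of "top_of_set X"] by simp
  then have R: "?R \<noteq> {}" "\<And>r. r \<in> ?R \<Longrightarrow> Card_order r"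
    using Card_order_dens by auto
  show "local_density_at X x \<in> ?R"
    unfolding local_density_at_def by (rule least_cardinal(1)[OF R])
  show "local_density_at X x \<le>o dens N" if "N \<subseteq> X" "x \<in> top_of_set X interior_of N" for N
    unfolding local_density_at_def by (rule least_cardinal(2)[OF R]) (use that in auto)
qed

lemma dens_le_card: "dens N \<le>o |N|"
  unfolding dens_def
  by (rule least_cardinal(2)) (use closure_subset[of N] in \<open>auto simp: card_of_Card_order\<close>)

lemma local_density:
  fixes X :: "'a::metric_space set"
  shows "Card_order (local_density X)"
    and "\<And>x. x \<in> X \<Longrightarrow> local_density_at X x \<le>o local_density X"
    and "\<And>r :: 'a rel. Card_order r \<Longrightarrow> (\<And>x. x \<in> X \<Longrightarrow> local_density_at X x \<le>o r)
           \<Longrightarrow> local_density X \<le>o r"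
proof -
  let ?R = "{r :: 'a rel. Card_order r \<and> (\<forall>x\<in>X. local_density_at X x \<le>o r)}"
  have "local_density_at X x \<le>o |X|" if "x \<in> X" for x
  proof -
    have "x \<in> top_of_set X interior_of X"
      using that interior_of_topspace[of "top_of_set X"] by simp
    then show ?thesis
      using local_density_at(2)[OF that order_refl] dens_le_card ordLeq_transitive by blast
  qed
  then have "|X| \<in> ?R"
    by (simp add: card_of_Card_order)
  then have R: "?R \<noteq> {}" "\<And>r. r \<in> ?R \<Longrightarrow> Card_order r"
    by auto
  have "local_density X \<in> ?R"
    unfolding local_density_def by (rule least_cardinal(1)[OF R])
  then show "Card_order (local_density X)"
    and "\<And>x. x \<in> X \<Longrightarrow> local_density_at X x \<le>o local_density X"
    by auto
  show "local_density X \<le>o r"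
    if "Card_order r" "\<And>x. x \<in> X \<Longrightarrow> local_density_at X x \<le>o r" for r :: "'a rel"
    unfolding local_density_def by (rule least_cardinal(2)[OF R]) (use that in auto)
qed

text \<open>
  The library's \<^const>\<open>cofinal\<close> asks for strict upper bounds, which agrees with unboundedness
  for infinite cardinals (these are limit ordinals). Only infinite cardinals are meant here.
\<close>

definition cofinality :: "'b rel \<Rightarrow> 'b rel" where
  "cofinality \<kappa> = least_cardinal {|A| | A. A \<subseteq> Field \<kappa> \<and> cofinal A \<kappa>}"

lemma cofinality:
  assumes "Card_order \<kappa>" and "infinite (Field \<kappa>)"
  shows "\<exists>A. A \<subseteq> Field \<kappa> \<and> cofinal A \<kappa> \<and> cofinality \<kappa> = |A|"
    and "\<And>A. A \<subseteq> Field \<kappa> \<Longrightarrow> cofinal A \<kappa> \<Longrightarrow> cofinality \<kappa> \<le>o |A|"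
proof -
  let ?R = "{|A| | A. A \<subseteq> Field \<kappa> \<and> cofinal A \<kappa>}"
  have "cofinal (Field \<kappa>) \<kappa>"
    unfolding cofinal_def using infinite_Card_order_limit[OF assms] by blast
  then have R: "?R \<noteq> {}" "\<And>r. r \<in> ?R \<Longrightarrow> Card_order r"
    by (auto simp: card_of_Card_order)
  show "\<exists>A. A \<subseteq> Field \<kappa> \<and> cofinal A \<kappa> \<and> cofinality \<kappa> = |A|"
    unfolding cofinality_def using least_cardinal(1)[OF R] by blast
  show "cofinality \<kappa> \<le>o |A|" if "A \<subseteq> Field \<kappa>" "cofinal A \<kappa>" for A
    unfolding cofinality_def by (rule least_cardinal(2)[OF R]) (use that in auto)
qed

definition uncountable_cofinality :: "'b rel \<Rightarrow> bool" where
  "uncountable_cofinality \<kappa> \<longleftrightarrow> natLeq <o cofinality \<kappa>"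


section \<open>The partially ordered sets\<close>

definition compact_subsets :: "'a::topological_space set \<Rightarrow> 'a set set" where
  "compact_subsets X = {K. K \<subseteq> X \<and> compact K}"

text \<open>The underlying set of a cardinal \<open>\<kappa>\<close> is \<^term>\<open>Field \<kappa>\<close>.\<close>

definition Fin :: "'b rel \<Rightarrow> 'b set set" where
  "Fin \<kappa> = Fpow (Field \<kappa>)"

definition Fin_seqs :: "'b rel \<Rightarrow> (nat \<Rightarrow> 'b set) set" where
  "Fin_seqs \<kappa> = {f. \<forall>n. f n \<in> Fin \<kappa>}"

text \<open>
  The ordinals below \<open>\<kappa>\<close> are the proper initial segments \<^term>\<open>underS \<kappa> a\<close>, where \<open>a\<close> is in
  the field of \<open>\<kappa>\<close>.
\<close>

definition Bdd_Fin_seqs :: "'b rel \<Rightarrow> (nat \<Rightarrow> 'b set) set" where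
  "Bdd_Fin_seqs \<kappa> = (\<Union>a\<in>Field \<kappa>. {f. \<forall>n. f n \<in> Fpow (underS \<kappa> a)})"

end

theory Submission
  imports Defs "HOL-Library.Countable_Set_Type"
begin

text \<open>
  Write \<open>d\<close> for the density and \<open>l\<close> for the local density of \<open>X\<close>.

  Cofinal maps \<^emph>\<open>into\<close> \<open>K(X)\<close> build compact sets. If \<open>X\<close> is not compact, it has a base of \<open>d\<close> many
  balls. In the locally compact case finite unions of compact balls suffice. In general, choose a
  dense set of at most \<open>l\<close> points near each sufficiently small ball of the base. A finite set of
  balls and, for every \<open>n\<close>, finitely many indices of points of these dense sets determine the set
  of all points that are, for some selected ball and all \<open>n\<close>, within \<open>1 / Suc n\<close> of the selected
  points. By completeness this set is compact, and every compact set is contained in such a set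
  (\<open>sequences_below_compact_subsets\<close>).

  Cofinal maps \<^emph>\<open>out of\<close> \<open>K(X)\<close> record compact sets. It suffices to treat the factors of the
  product separately, because \<open>K(X)\<close> is directed. The key is \<open>finite_record\<close>: if \<open>S\<close> is not
  totally bounded, compact sets can be mapped monotonically to finite subsets of a set of size
  \<open>dens S\<close>, in such a way that every finite subset is reached by a condition that finitely many
  points of \<open>S\<close> enforce. Applied to \<open>S = X\<close> this gives the factor \<open>Fin d\<close>. Applied to a sequence of
  balls shrinking to a point \<open>x\<close> it gives sequences of finite subsets of the local density at
  \<open>x\<close>, because finite subsets of the balls add up to a compact set
  (\<open>compact_subsets_below_sequences\<close>).

  If \<open>l\<close> is realized, one point \<open>x\<close> suffices. Otherwise every point, and hence every finite set of
  points, only yields sequences bounded below \<open>l\<close>. The local density is upper semicontinuous,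
  so \<open>d\<close> many representative points, indexed by the base, attain all relevant values; a compact
  set uses the finitely many representatives that its record in \<open>Fin d\<close> names
  (\<open>compact_subsets_below_Bdd\<close>). If \<open>l\<close> has uncountable cofinality, every sequence of finite sets
  is bounded, so the two descriptions agree.
\<close>


section \<open>Cofinal maps\<close>

lemma cofinal_belowI:
  assumes "\<And>p. p \<in> P \<Longrightarrow> \<psi> p \<in> Q"
    and "\<And>p p'. p \<in> P \<Longrightarrow> p' \<in> P \<Longrightarrow> p \<le> p' \<Longrightarrow> \<psi> p \<le> \<psi> p'"
    and "\<And>q. q \<in> Q \<Longrightarrow> \<exists>p\<in>P. q \<le> \<psi> p"
  shows "P \<preceq>\<^sub>c Q"
  unfolding cofinal_below_def
  by (rule exI[of _ \<psi>]) (use assms in \<open>auto intro!: mono_onI\<close>)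

text \<open>
  Maps into the factors can be paired because a directed set contains an upper bound of any two
  witnesses.
\<close>

lemma cofinal_below_Times:
  assumes "P \<preceq>\<^sub>c Q" "P \<preceq>\<^sub>c R"
    and directed: "\<And>p p'. p \<in> P \<Longrightarrow> p' \<in> P \<Longrightarrow> \<exists>u\<in>P. p \<le> u \<and> p' \<le> u"
  shows "P \<preceq>\<^sub>c Q \<times> R"
proof -
  obtain \<phi> where \<phi>: "\<phi> ` P \<subseteq> Q" "mono_on P \<phi>" "\<forall>q\<in>Q. \<exists>p\<in>P. q \<le> \<phi> p"
    using assms(1) unfolding cofinal_below_def by blast
  obtain \<psi> where \<psi>: "\<psi> ` P \<subseteq> R" "mono_on P \<psi>" "\<forall>q\<in>R. \<exists>p\<in>P. q \<le> \<psi> p"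
    using assms(2) unfolding cofinal_below_def by blast
  show ?thesis
  proof (rule cofinal_belowI[where \<psi> = "\<lambda>p. (\<phi> p, \<psi> p)"])
    show "(\<phi> p, \<psi> p) \<in> Q \<times> R" if "p \<in> P" for p
      using \<phi>(1) \<psi>(1) that by auto
    show "(\<phi> p, \<psi> p) \<le> (\<phi> p', \<psi> p')" if "p \<in> P" "p' \<in> P" "p \<le> p'" for p p'
      using \<phi>(2) \<psi>(2) that by (auto dest: mono_onD)
    fix x assume "x \<in> Q \<times> R"
    then obtain q r where x: "x = (q, r)" "q \<in> Q" "r \<in> R" by blast
    obtain p p' where p: "p \<in> P" "p' \<in> P" "q \<le> \<phi> p" "r \<le> \<psi> p'"
      using \<phi>(3) \<psi>(3) x by blast
    then obtain u where u: "u \<in> P" "p \<le> u" "p' \<le> u" using directed by blast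
    have "q \<le> \<phi> u" "r \<le> \<psi> u"
      using p u mono_onD[OF \<phi>(2), of p u] mono_onD[OF \<psi>(2), of p' u] by (auto intro: order_trans)
    then show "\<exists>p\<in>P. x \<le> (\<phi> p, \<psi> p)" using u x by auto
  qed
qed

lemma compact_subsets_directed:
  "K \<in> compact_subsets X \<Longrightarrow> L \<in> compact_subsets X \<Longrightarrow>
    \<exists>M\<in>compact_subsets X. K \<le> M \<and> L \<le> M"
  by (rule bexI[of _ "K \<union> L"]) (auto simp: compact_subsets_def compact_Un)


section \<open>Separated sets and total boundedness\<close>

definition spaced :: "real \<Rightarrow> 'a::metric_space set \<Rightarrow> bool" where
  "spaced e M \<longleftrightarrow> pairwise (\<lambda>x y. e \<le> dist x y) M"

text \<open>
  This is the usual notion of total boundedness; the negation directly provides an infinite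
  separated set.
\<close>

definition totally_bdd :: "'a::metric_space set \<Rightarrow> bool" where
  "totally_bdd S \<longleftrightarrow> (\<forall>e>0. \<forall>E\<subseteq>S. spaced e E \<longrightarrow> finite E)"

lemma finite_imp_totally_bdd: "finite S \<Longrightarrow> totally_bdd S"
  unfolding totally_bdd_def using finite_subset by blast

lemma totally_bdd_subset: "totally_bdd S \<Longrightarrow> T \<subseteq> S \<Longrightarrow> totally_bdd T"
  unfolding totally_bdd_def by blast

lemma finite_compact_Int_spaced:
  assumes "compact K" "spaced e E" "0 < e"
  shows "finite (K \<inter> E)"
proof -
  have "uniform_discrete E"
    using assms unfolding uniform_discrete_def spaced_def pairwise_def by (meson not_le)
  then have "closed E" "discrete (K \<inter> E)"
    by (auto intro: uniform_discrete_imp_closed uniform_discrete_imp_discrete)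
  then show ?thesis
    using discrete_compact_finite_iff[of "K \<inter> E"] compact_Int_closed[OF assms(1)] by blast
qed

lemma maximal_spaced:
  fixes S :: "'a::metric_space set"
  assumes "0 < e"
  obtains M where "M \<subseteq> S" "spaced e M" "\<And>x. x \<in> S \<Longrightarrow> \<exists>p\<in>M. dist p x < e"
proof -
  let ?A = "{M. M \<subseteq> S \<and> spaced e M}"
  have "\<exists>M\<in>?A. \<forall>N\<in>?A. M \<subseteq> N \<longrightarrow> N = M"
  proof (rule subset_Zorn')
    fix C assume C: "subset.chain ?A C"
    have "spaced e (\<Union>C)"
      unfolding spaced_def
      by (rule pairwise_chain_Union)
        (use C in \<open>auto simp: subset_chain_def chain_subset_def spaced_def\<close>)
    then show "\<Union>C \<in> ?A" using C by (auto simp: subset_chain_def)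
  qed
  then obtain M where *: "M \<in> ?A" "\<forall>N\<in>?A. M \<subseteq> N \<longrightarrow> N = M" ..
  have M: "M \<subseteq> S" "spaced e M" using *(1) by auto
  have max: "N = M" if "N \<subseteq> S" "spaced e N" "M \<subseteq> N" for N
    using *(2) that by auto
  have "\<exists>p\<in>M. dist p x < e" if "x \<in> S" for x
  proof (rule ccontr)
    assume far: "\<not> (\<exists>p\<in>M. dist p x < e)"
    then have "spaced e (insert x M)"
      using M(2) unfolding spaced_def by (auto simp: pairwise_insert dist_commute not_less)
    then have "x \<in> M" using max[of "insert x M"] M(1) that by auto
    then show False using far assms by force
  qed
  then show thesis using that M by blast
qed

lemma dens_witness:
  obtains D where "D \<subseteq> N" "N \<subseteq> closure D" "dens N = |D|"
proof -
  have "dens N \<in> {|D| | D. D \<subseteq> N \<and> N \<subseteq> closure D}"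
    unfolding dens_def
    by (rule least_cardinal(1)) (use closure_subset[of N] in \<open>auto simp: card_of_Card_order\<close>)
  then show thesis using that by auto
qed

lemma dens_le: "D \<subseteq> N \<Longrightarrow> N \<subseteq> closure D \<Longrightarrow> dens N \<le>o |D|"
  unfolding dens_def
  by (rule least_cardinal(2)) (auto simp: card_of_Card_order)

lemma infinite_dense_subset:
  assumes "\<not> totally_bdd S" "S \<subseteq> closure D"
  shows "infinite D"
proof
  assume D: "finite D"
  then have "closure D = D" by (simp add: finite_imp_closed)
  then show False
    using assms D finite_imp_totally_bdd[of S] finite_subset[of S D] by simp
qed

text \<open>
  The union of maximal separated sets for the distances \<open>1 / Suc k\<close> is dense. The union is kept
  disjoint, so that the members of each net are counted with their index.
\<close>

lemma spaced_nets:
  fixes S :: "'a::metric_space set"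
  obtains M :: "nat \<Rightarrow> 'a set" where "\<And>k. M k \<subseteq> S" "\<And>k. spaced (1 / Suc k) (M k)"
    "dens S \<le>o |SIGMA k:UNIV. M k|"
proof -
  have "\<exists>M. M \<subseteq> S \<and> spaced (1 / Suc k) M \<and> (\<forall>x\<in>S. \<exists>p\<in>M. dist p x < 1 / Suc k)" for k
    using maximal_spaced[of "1 / Suc k" S] by (metis zero_less_one divide_pos_pos of_nat_0_less_iff zero_less_Suc)
  then obtain M where M: "\<And>k. M k \<subseteq> S" "\<And>k. spaced (1 / Suc k) (M k)"
    "\<And>k x. x \<in> S \<Longrightarrow> \<exists>p\<in>M k. dist p x < 1 / Suc k"
    by metis
  have "S \<subseteq> closure (\<Union>k. M k)"
  proof
    fix x assume x: "x \<in> S"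
    show "x \<in> closure (\<Union>k. M k)"
      unfolding closure_approachable
    proof (intro allI impI)
      fix e :: real assume "0 < e"
      then obtain k where "1 / Suc k < e" using nat_approx_posE by blast
      then show "\<exists>y\<in>\<Union>k. M k. dist y x < e" using M(3)[OF x, of k] by force
    qed
  qed
  then have "dens S \<le>o |\<Union>k. M k|" using M(1) by (intro dens_le) auto
  also have "|\<Union>k. M k| \<le>o |SIGMA k:UNIV. M k|"
  proof -
    have "(\<Union>k. M k) = snd ` (SIGMA k:UNIV. M k)" by force
    then show ?thesis using card_of_image by metis
  qed
  finally have "dens S \<le>o |SIGMA k:UNIV. M k|" .
  then show thesis using that M by blast
qed

lemma totally_bdd_dens:
  assumes "totally_bdd S"
  shows "dens S \<le>o natLeq"
proof -
  obtain M where M: "\<And>k. M k \<subseteq> S" "\<And>k. spaced (1 / Suc k) (M k)"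
    "dens S \<le>o |SIGMA k:UNIV. M k|"
    using spaced_nets[of S] by metis
  have "finite (M k)" for k
    using assms M(1,2)[of k] unfolding totally_bdd_def by (meson divide_pos_pos of_nat_0_less_iff zero_less_Suc zero_less_one)
  then have "countable (SIGMA k:UNIV. M k)"
    by (intro countable_SIGMA) (auto intro: countable_finite)
  then show ?thesis
    using M(3) countable_card_le_natLeq[THEN iffD1] ordLeq_transitive by blast
qed

lemma complete_totally_bdd_compact:
  assumes "complete S" "totally_bdd S"
  shows "compact S"
  unfolding compact_eq_totally_bounded
proof (intro conjI allI impI assms(1))
  fix e :: real assume e: "0 < e"
  obtain M where M: "M \<subseteq> S" "spaced e M" "\<And>x. x \<in> S \<Longrightarrow> \<exists>p\<in>M. dist p x < e"
    using maximal_spaced[OF e, of S] by metis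
  have "finite M" using assms(2) M e unfolding totally_bdd_def by blast
  then show "\<exists>k. finite k \<and> S \<subseteq> (\<Union>x\<in>k. ball x e)" using M(3) by (intro exI[of _ M]) auto
qed


section \<open>Recording compact sets by finite sets\<close>

text \<open>
  This is the source of all maps that start at compact sets. Index \<open>A\<close> by the disjoint union of
  the nets \<open>M k\<close> of \<open>S\<close>. A compact set meets each net in a finite set, but it may meet infinitely
  many of them. The set itself therefore supplies a bound for the levels that are inspected: an
  infinite separated sequence \<open>s\<close> in \<open>S\<close> exists, a compact set contains \<open>s m\<close> for finitely many
  \<open>m\<close> only, and only levels up to the largest such \<open>m\<close> are inspected. Conversely a finite set of
  indices is recorded as soon as the compact set contains the corresponding net points and, for
  each of them, a member of the sequence with a large enough index. No net has to reach the full
  density of \<open>S\<close>, so densities of countable cofinality need no separate treatment.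
\<close>

lemma finite_record:
  fixes S :: "'a::metric_space set" and A :: "'b set"
  assumes "\<not> totally_bdd S" "|A| \<le>o dens S"
  obtains \<Phi> :: "'a set \<Rightarrow> 'b set" where "mono \<Phi>"
    "\<And>K. compact K \<Longrightarrow> \<Phi> K \<in> Fpow A"
    "\<And>g. g \<in> Fpow A \<Longrightarrow> \<exists>F\<in>Fpow S. \<forall>K. F \<subseteq> K \<longrightarrow> g \<subseteq> \<Phi> K"
proof -
  obtain e E where E: "0 < e" "E \<subseteq> S" "spaced e E" "infinite E"
    using assms(1) unfolding totally_bdd_def by blast
  obtain s :: "nat \<Rightarrow> 'a" where s: "inj s" "range s \<subseteq> E"
    using infinite_countable_subset[OF E(4)] by blast
  obtain M where M: "\<And>k. M k \<subseteq> S" "\<And>k. spaced (1 / Suc k) (M k)"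
    "dens S \<le>o |SIGMA k:UNIV. M k|"
    using spaced_nets[of S] by metis
  obtain h where h: "inj_on h A" "h ` A \<subseteq> (SIGMA k:UNIV. M k)"
    using ordLeq_transitive[OF assms(2) M(3)] unfolding card_of_ordLeq[symmetric] by blast
  define \<Phi> where "\<Phi> K = {\<alpha>\<in>A. snd (h \<alpha>) \<in> K \<and> (\<exists>m\<ge>fst (h \<alpha>). s m \<in> K)}" for K
  have "mono \<Phi>" unfolding mono_def \<Phi>_def by blast
  moreover have "\<Phi> K \<in> Fpow A" if K: "compact K" for K
  proof -
    have "finite (s ` (s -` K))"
      by (rule finite_subset[OF _ finite_compact_Int_spaced[OF K E(3,1)]]) (use s in auto)
    then have "finite (s -` K)" using s(1) by (meson finite_imageD inj_on_subset subset_UNIV)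
    then obtain n where n: "\<And>m. s m \<in> K \<Longrightarrow> m \<le> n"
      using finite_nat_set_iff_bounded_le[of "s -` K"] by auto
    have "finite (SIGMA k:{..n}. K \<inter> M k)"
      by (intro finite_SigmaI) (auto intro: finite_compact_Int_spaced[OF K M(2)])
    moreover have "h ` \<Phi> K \<subseteq> (SIGMA k:{..n}. K \<inter> M k)"
    proof
      fix y assume "y \<in> h ` \<Phi> K"
      then obtain \<alpha> m where \<alpha>: "y = h \<alpha>" "\<alpha> \<in> A" "snd (h \<alpha>) \<in> K" "fst (h \<alpha>) \<le> m" "s m \<in> K"
        unfolding \<Phi>_def by blast
      then have "fst (h \<alpha>) \<le> n" using n[of m] by simp
      moreover have "h \<alpha> \<in> (SIGMA k:UNIV. M k)" using h(2) \<alpha>(2) by blast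
      ultimately show "y \<in> (SIGMA k:{..n}. K \<inter> M k)" using \<alpha> by (auto simp: mem_Times_iff Sigma_def split_beta)
    qed
    ultimately have "finite (h ` \<Phi> K)" by (rule finite_subset[rotated])
    then have "finite (\<Phi> K)"
      by (rule finite_imageD) (rule inj_on_subset[OF h(1)], auto simp: \<Phi>_def)
    then show ?thesis by (auto simp: Fpow_def \<Phi>_def)
  qed
  moreover have "\<exists>F\<in>Fpow S. \<forall>K. F \<subseteq> K \<longrightarrow> g \<subseteq> \<Phi> K" if g: "g \<in> Fpow A" for g
  proof (intro bexI allI impI)
    let ?F = "(\<lambda>\<alpha>. snd (h \<alpha>)) ` g \<union> (\<lambda>\<alpha>. s (fst (h \<alpha>))) ` g"
    have "snd (h \<alpha>) \<in> S" if "\<alpha> \<in> A" for \<alpha>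
    proof -
      have "h \<alpha> \<in> (SIGMA k:UNIV. M k)" using h(2) that by blast
      then show ?thesis using M(1)[of "fst (h \<alpha>)"] by (auto simp: mem_Sigma_iff split_beta Sigma_def)
    qed
    then show "?F \<in> Fpow S" using g s(2) E(2) unfolding Fpow_def by auto
    show "g \<subseteq> \<Phi> K" if "?F \<subseteq> K" for K
      using that g unfolding \<Phi>_def Fpow_def by auto
  qed
  ultimately show thesis using that by blast
qed

lemma compact_subsets_below_Fpow:
  fixes X :: "'a::metric_space set" and A :: "'b set"
  assumes "\<not> totally_bdd X" "|A| \<le>o dens X"
  shows "compact_subsets X \<preceq>\<^sub>c Fpow A"
proof -
  obtain \<Phi> :: "'a set \<Rightarrow> 'b set" where \<Phi>: "mono \<Phi>" "\<And>K. compact K \<Longrightarrow> \<Phi> K \<in> Fpow A"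
    "\<And>g. g \<in> Fpow A \<Longrightarrow> \<exists>F\<in>Fpow X. \<forall>K. F \<subseteq> K \<longrightarrow> g \<subseteq> \<Phi> K"
    using finite_record[OF assms] by metis
  show ?thesis
  proof (rule cofinal_belowI[where \<psi> = \<Phi>])
    fix g assume "g \<in> Fpow A"
    then obtain F where "F \<in> Fpow X" "g \<subseteq> \<Phi> F" using \<Phi>(3) by blast
    then show "\<exists>K\<in>compact_subsets X. g \<le> \<Phi> K"
      by (auto simp: compact_subsets_def Fpow_def finite_imp_compact)
  qed (use \<Phi> in \<open>auto simp: compact_subsets_def mono_def\<close>)
qed

text \<open>
  In a complete space these are the points without a compact neighbourhood. Total boundedness is
  used because it passes to subsets, as neighbourhoods shrink.
\<close>

definition nonprecompact_at :: "'a::metric_space set \<Rightarrow> 'a \<Rightarrow> bool" where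
  "nonprecompact_at X x \<longleftrightarrow> x \<in> X \<and> (\<forall>e>0. \<not> totally_bdd (X \<inter> ball x e))"

lemma nonprecompact_at_not_totally_bdd:
  "nonprecompact_at X x \<Longrightarrow> \<not> totally_bdd X"
  unfolding nonprecompact_at_def
  using totally_bdd_subset[of X "X \<inter> ball x 1"] by auto

lemma ball_neighbourhood:
  "x \<in> X \<Longrightarrow> 0 < e \<Longrightarrow> x \<in> top_of_set X interior_of (X \<inter> ball x e)"
  unfolding interior_of_def by (auto intro!: exI[of _ "X \<inter> ball x e"] openin_open_Int)

lemma neighbourhood_ball:
  assumes "x \<in> top_of_set X interior_of N"
  obtains e where "0 < e" "X \<inter> ball x e \<subseteq> top_of_set X interior_of N"
proof -
  obtain T where T: "x \<in> T" "openin (top_of_set X) T" "T \<subseteq> N"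
    using assms unfolding interior_of_def by blast
  obtain e where "0 < e" "ball x e \<inter> X \<subseteq> T"
    using T openin_contains_ball[of X T] by blast
  moreover have "T \<subseteq> top_of_set X interior_of N" using T unfolding interior_of_def by blast
  ultimately show thesis using that by blast
qed

text \<open>
  Coordinate \<open>n\<close> records what happens in the ball of radius \<open>1 / Suc n\<close> about \<open>x\<close>. The
  coordinates can be prescribed simultaneously, because finite subsets of these shrinking balls
  together with \<open>x\<close> form a compact set.
\<close>

lemma compact_subsets_below_sequences:
  fixes X :: "'a::metric_space set" and A :: "'b set"
  assumes x: "nonprecompact_at X x" and A: "|A| \<le>o local_density_at X x"
  shows "compact_subsets X \<preceq>\<^sub>c {f :: nat \<Rightarrow> 'b set. \<forall>n. f n \<in> Fpow A}"
proof -
  define B where "B n = X \<inter> ball x (1 / Suc n)" for n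
  have xX: "x \<in> X" and B: "\<not> totally_bdd (B n)" for n
    using x unfolding nonprecompact_at_def B_def by auto
  have "|A| \<le>o dens (B n)" for n
    using A local_density_at(2)[OF xX, of "B n"] ball_neighbourhood[OF xX, of "1 / Suc n"]
    by (auto simp: B_def intro: ordLeq_transitive)
  then have "\<exists>\<Phi> :: 'a set \<Rightarrow> 'b set. mono \<Phi> \<and> (\<forall>K. compact K \<longrightarrow> \<Phi> K \<in> Fpow A) \<and>
      (\<forall>g\<in>Fpow A. \<exists>F\<in>Fpow (B n). \<forall>K. F \<subseteq> K \<longrightarrow> g \<subseteq> \<Phi> K)" for n
    using finite_record[OF B] by metis
  then obtain \<Phi> :: "nat \<Rightarrow> 'a set \<Rightarrow> 'b set" where \<Phi>: "\<And>n. mono (\<Phi> n)"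
    "\<And>n K. compact K \<Longrightarrow> \<Phi> n K \<in> Fpow A"
    "\<And>n g. g \<in> Fpow A \<Longrightarrow> \<exists>F\<in>Fpow (B n). \<forall>K. F \<subseteq> K \<longrightarrow> g \<subseteq> \<Phi> n K"
    by metis
  show ?thesis
  proof (rule cofinal_belowI[where \<psi> = "\<lambda>K n. \<Phi> n K"])
    fix f :: "nat \<Rightarrow> 'b set" assume "f \<in> {f. \<forall>n. f n \<in> Fpow A}"
    then have "\<forall>n. \<exists>F\<in>Fpow (B n). \<forall>K. F \<subseteq> K \<longrightarrow> f n \<subseteq> \<Phi> n K" using \<Phi>(3) by blast
    then obtain F where F: "\<And>n. F n \<in> Fpow (B n)" "\<And>n K. F n \<subseteq> K \<Longrightarrow> f n \<subseteq> \<Phi> n K"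
      by metis
    define K where "K = insert x (\<Union>n. F n)"
    have "compact K"
      unfolding compact_eq_Heine_Borel
    proof (intro allI impI)
      fix \<U> assume "(\<forall>t\<in>\<U>. open t) \<and> K \<subseteq> \<Union>\<U>"
      then have \<U>: "\<And>t. t \<in> \<U> \<Longrightarrow> open t" "K \<subseteq> \<Union>\<U>" by auto
      then obtain U where U: "U \<in> \<U>" "x \<in> U" "open U" unfolding K_def by blast
      then obtain e where e: "0 < e" "ball x e \<subseteq> U" using open_contains_ball by blast
      then obtain k where k: "1 / Suc k < e" using nat_approx_posE by blast
      have tail: "F n \<subseteq> U" if "k \<le> n" for n
      proof -
        have "1 / Suc n \<le> 1 / Suc k" using that by (intro divide_left_mono) auto
        then have "B n \<subseteq> ball x e" using k unfolding B_def by (auto simp: dist_commute)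
        then show ?thesis using F(1)[of n] e(2) unfolding Fpow_def by auto
      qed
      have "compact (\<Union>n<k. F n)" using F(1) by (intro finite_imp_compact) (auto simp: Fpow_def)
      moreover have "(\<Union>n<k. F n) \<subseteq> \<Union>\<U>" using \<U>(2) unfolding K_def by auto
      ultimately obtain \<V> where \<V>: "\<V> \<subseteq> \<U>" "finite \<V>" "(\<Union>n<k. F n) \<subseteq> \<Union>\<V>"
        using \<U>(1) by (meson compactE)
      have "F n \<subseteq> \<Union>(insert U \<V>)" for n
        using tail[of n] \<V>(3) by (cases "n < k") (auto simp: not_less)
      then have "K \<subseteq> \<Union>(insert U \<V>)"
        using U unfolding K_def by auto
      then show "\<exists>\<V>\<subseteq>\<U>. finite \<V> \<and> K \<subseteq> \<Union>\<V>" using \<V> U by (intro exI[of _ "insert U \<V>"]) auto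
    qed
    moreover have "K \<subseteq> X" using F(1) xX unfolding K_def B_def Fpow_def by blast
    moreover have "f n \<subseteq> \<Phi> n K" for n using F(2)[of n K] unfolding K_def by blast
    ultimately show "\<exists>K\<in>compact_subsets X. f \<le> (\<lambda>n. \<Phi> n K)"
      by (auto simp: compact_subsets_def le_fun_def)
  qed (use \<Phi>(1,2) in \<open>auto simp: compact_subsets_def le_fun_def mono_def\<close>)
qed

section \<open>Building compact sets from finite sets\<close>

text \<open>
  A space that is not totally bounded has infinite dense sets only, so pairing the members of a
  dense set with countably many radii does not increase its cardinality.
\<close>

lemma ball_base_indexed_by_dens:
  fixes X :: "'a::metric_space set"
  assumes "\<not> totally_bdd X"
  obtains c :: "'a \<Rightarrow> 'a" and r :: "'a \<Rightarrow> real"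
  where "\<And>x e. x \<in> X \<Longrightarrow> 0 < e \<Longrightarrow>
    \<exists>j\<in>Field (dens X). x \<in> ball (c j) (r j) \<and> cball (c j) (r j) \<subseteq> ball x e"
proof -
  obtain D where D: "D \<subseteq> X" "X \<subseteq> closure D" "dens X = |D|" using dens_witness by blast
  have inf: "infinite D" using infinite_dense_subset[OF assms D(2)] .
  then have "|UNIV :: nat set| \<le>o |D|"
    using infinite_iff_card_of_nat by blast
  then have "|D \<times> (UNIV :: nat set)| \<le>o |D|"
    using card_of_Times_infinite_simps(1)[OF inf] ordIso_imp_ordLeq by blast
  moreover have "D \<times> (UNIV :: nat set) \<noteq> {}" using inf by auto
  ultimately obtain g :: "'a \<Rightarrow> 'a \<times> nat" where g: "g ` D = D \<times> UNIV"
    using card_of_ordLeq2 by metis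
  show thesis
  proof (rule that[of "\<lambda>j. fst (g j)" "\<lambda>j. 1 / Suc (snd (g j))"])
    fix x and e :: real assume x: "x \<in> X" "0 < e"
    then obtain n where n: "1 / Suc n < e / 2" using nat_approx_posE[of "e/2"] by auto
    obtain d where d: "d \<in> D" "dist d x < 1 / Suc n"
      using D(2) x(1) unfolding closure_approachable subset_iff
      by (meson divide_pos_pos of_nat_0_less_iff zero_less_Suc zero_less_one)
    obtain j where j: "j \<in> D" "g j = (d, n)" using g d(1) by (metis UNIV_I imageE mem_Sigma_iff)
    have "cball d (1 / Suc n) \<subseteq> ball x e"
    proof
      fix y assume "y \<in> cball d (1 / Suc n)"
      then have "dist d y \<le> 1 / Suc n" by simp
      then have "dist x y < e" using dist_triangle[of x y d] d(2) n by (simp add: dist_commute)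
      then show "y \<in> ball x e" by simp
    qed
    then show "\<exists>j\<in>Field (dens X). x \<in> ball (fst (g j)) (1 / real (Suc (snd (g j)))) \<and>
        cball (fst (g j)) (1 / real (Suc (snd (g j)))) \<subseteq> ball x e"
      using j d(2) D(3) by (intro bexI[of _ j]) (auto simp: Field_card_of)
  qed
qed

text \<open>
  The balls of the base whose closed versions have a compact trace on \<open>X\<close> cover \<open>X\<close>.
\<close>

lemma Fin_below_compact_subsets:
  fixes X :: "'a::metric_space set"
  assumes X: "\<not> totally_bdd X" and lc: "locally_compact_space (top_of_set X)"
  shows "Fin (dens X) \<preceq>\<^sub>c compact_subsets X"
proof -
  obtain c r where cr: "\<And>x e. x \<in> X \<Longrightarrow> 0 < e \<Longrightarrow>
    \<exists>j\<in>Field (dens X). x \<in> ball (c j) (r j) \<and> cball (c j) (r j) \<subseteq> ball x e"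
    using ball_base_indexed_by_dens[OF X] by metis
  define J where "J = {j\<in>Field (dens X). compact (X \<inter> cball (c j) (r j))}"
  have cover: "\<exists>j\<in>J. x \<in> ball (c j) (r j)" if x: "x \<in> X" for x
  proof -
    obtain U K where U: "openin (top_of_set X) U" "compactin (top_of_set X) K" "x \<in> U" "U \<subseteq> K"
      using lc x unfolding locally_compact_space_def by auto
    then have K: "compact K" "K \<subseteq> X" by (auto simp: compactin_subtopology)
    obtain e where e: "0 < e" "ball x e \<inter> X \<subseteq> U"
      using U openin_contains_ball[of X U] by blast
    obtain j where j: "j \<in> Field (dens X)" "x \<in> ball (c j) (r j)" "cball (c j) (r j) \<subseteq> ball x e"
      using cr[OF x e(1)] by blast
    have "X \<inter> cball (c j) (r j) = K \<inter> cball (c j) (r j)"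
      using e(2) U(4) j(3) K(2) by blast
    then have "compact (X \<inter> cball (c j) (r j))" using K(1) by (simp add: compact_Int_closed)
    then show ?thesis using j unfolding J_def by blast
  qed
  show ?thesis
  proof (rule cofinal_belowI[where \<psi> = "\<lambda>F. \<Union>j\<in>F \<inter> J. X \<inter> cball (c j) (r j)"])
    fix F assume "F \<in> Fin (dens X)"
    then have "finite (F \<inter> J)" unfolding Fin_def Fpow_def by auto
    then have "compact (\<Union>j\<in>F \<inter> J. X \<inter> cball (c j) (r j))"
      by (intro compact_UN) (auto simp: J_def)
    then show "(\<Union>j\<in>F \<inter> J. X \<inter> cball (c j) (r j)) \<in> compact_subsets X"
      unfolding compact_subsets_def by auto
  next
    fix K assume "K \<in> compact_subsets X"
    then have K: "compact K" "K \<subseteq> X" unfolding compact_subsets_def by auto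
    have "K \<subseteq> (\<Union>j\<in>J. ball (c j) (r j))" using cover K(2) by blast
    then obtain F where F: "F \<subseteq> J" "finite F" "K \<subseteq> (\<Union>j\<in>F. ball (c j) (r j))"
      using compactE_image[OF K(1), of J "\<lambda>j. ball (c j) (r j)"] by auto
    have "F \<in> Fin (dens X)" using F unfolding Fin_def Fpow_def J_def by auto
    moreover have "K \<subseteq> (\<Union>j\<in>F \<inter> J. X \<inter> cball (c j) (r j))"
      using F K(2) by (force simp: mem_ball)
    ultimately show "\<exists>F\<in>Fin (dens X). K \<le> (\<Union>j\<in>F \<inter> J. X \<inter> cball (c j) (r j))" by blast
  qed blast
qed

text \<open>
  If the points \<open>h \<alpha>\<close> with \<open>\<alpha> \<in> f n\<close> are prescribed as the centres of a cover by balls of radius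
  \<open>1 / Suc n\<close>, for every \<open>n\<close>, the points of a complete space that obey all prescriptions form a
  closed and totally bounded set.
\<close>

lemma compact_prescribed_nets:
  fixes X :: "'a::metric_space set"
  assumes "complete X" "\<And>n :: nat. finite (f n)"
  shows "compact (X \<inter> (\<Inter>n. \<Union>\<alpha>\<in>f n. cball (h \<alpha>) (1 / Suc n)))" (is "compact ?C")
  unfolding compact_eq_totally_bounded
proof (intro conjI allI impI)
  have "closed (\<Inter>n. \<Union>\<alpha>\<in>f n. cball (h \<alpha>) (1 / Suc n))"
    using assms(2) by (intro closed_INT ballI closed_UN) auto
  then show "complete ?C" using assms(1) by (rule complete_Int_closed[rotated])
  fix e :: real assume "0 < e"
  then obtain n where n: "1 / Suc n < e" using nat_approx_posE by blast
  have "?C \<subseteq> (\<Union>\<alpha>\<in>f n. cball (h \<alpha>) (1 / Suc n))" by blast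
  also have "\<dots> \<subseteq> (\<Union>x\<in>h ` f n. ball x e)" using n by force
  finally show "\<exists>k. finite k \<and> ?C \<subseteq> (\<Union>x\<in>k. ball x e)"
    using assms(2) by (intro exI[of _ "h ` f n"]) auto
qed

text \<open>
  Finitely many \<open>U j\<close> cover a given compact set, and in each of them the nets may be chosen from
  the dense set \<open>h j ` A j\<close>. The family \<open>P\<close> of admissible sequences is a parameter so that the
  same argument serves all sequences and the bounded ones.
\<close>

lemma sequences_below_compact_subsets:
  fixes X :: "'a::metric_space set" and A :: "'j \<Rightarrow> 'b set" and h :: "'j \<Rightarrow> 'b \<Rightarrow> 'a"
    and P :: "(nat \<Rightarrow> 'b set) set"
  assumes X: "complete X"
    and U: "\<And>j. j \<in> J \<Longrightarrow> open (U j)" "X \<subseteq> (\<Union>j\<in>J. U j)"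
    and h: "\<And>j. j \<in> J \<Longrightarrow> X \<inter> U j \<subseteq> closure (h j ` A j)"
    and P: "\<And>f n. f \<in> P \<Longrightarrow> finite (f n)"
      "\<And>F f. F \<in> Fpow J \<Longrightarrow> (\<And>n. f n \<in> Fpow (\<Union>j\<in>F. A j)) \<Longrightarrow> f \<in> P"
  shows "Fpow J \<times> P \<preceq>\<^sub>c compact_subsets X"
proof -
  define C where "C f j = X \<inter> (\<Inter>n. \<Union>\<alpha>\<in>f n. cball (h j \<alpha>) (1 / Suc n))" for f :: "nat \<Rightarrow> 'b set" and j
  have C_mono: "C f j \<subseteq> C f' j" if "f \<le> f'" for f f' j
    using that unfolding C_def le_fun_def by blast
  show ?thesis
  proof (rule cofinal_belowI[where \<psi> = "\<lambda>(F, f). \<Union>j\<in>F. C f j"])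
    fix p assume "p \<in> Fpow J \<times> P"
    then obtain F f where p: "p = (F, f)" "finite F" "f \<in> P" unfolding Fpow_def by blast
    have "compact (C f j)" for j
      unfolding C_def using compact_prescribed_nets[OF X, of f] P(1) p(3) by blast
    then have "compact (\<Union>j\<in>F. C f j)" using p(2) by (intro compact_UN) auto
    then show "(case p of (F, f) \<Rightarrow> \<Union>j\<in>F. C f j) \<in> compact_subsets X"
      unfolding p compact_subsets_def C_def by auto
  next
    fix p p' :: "'j set \<times> (nat \<Rightarrow> 'b set)" assume "p \<le> p'"
    then show "(case p of (F, f) \<Rightarrow> \<Union>j\<in>F. C f j) \<le> (case p' of (F, f) \<Rightarrow> \<Union>j\<in>F. C f j)"
      using C_mono[of "snd p" "snd p'"] by (cases p; cases p') (auto; blast)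
  next
    fix K assume "K \<in> compact_subsets X"
    then have K: "compact K" "K \<subseteq> X" unfolding compact_subsets_def by auto
    obtain F where F: "F \<subseteq> J" "finite F" "K \<subseteq> (\<Union>j\<in>F. U j)"
      using compactE_image[OF K(1), of J U] U K(2) by (metis order_trans)
    have "\<exists>g\<in>Fpow (A j). K \<inter> U j \<subseteq> (\<Union>\<alpha>\<in>g. cball (h j \<alpha>) (1 / Suc n))" if "j \<in> F" for j n
    proof -
      have "K \<inter> U j \<subseteq> closure (h j ` A j)" using h[of j] that F(1) K(2) by blast
      then have dense: "closure (K \<inter> U j) \<subseteq> closure (h j ` A j)" by (simp add: closure_minimal)
      \<comment> \<open>The trace of \<open>K\<close> on the open set \<open>U j\<close> need not be compact, but its closure is.\<close>
      have cl: "closure (K \<inter> U j) \<subseteq> (\<Union>\<alpha>\<in>A j. ball (h j \<alpha>) (1 / Suc n))"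
      proof
        fix x assume "x \<in> closure (K \<inter> U j)"
        then have "x \<in> closure (h j ` A j)" using dense by blast
        moreover have "0 < 1 / real (Suc n)" by simp
        ultimately have "\<exists>y\<in>h j ` A j. dist y x < 1 / real (Suc n)"
          unfolding closure_approachable by blast
        then show "x \<in> (\<Union>\<alpha>\<in>A j. ball (h j \<alpha>) (1 / Suc n))" by auto
      qed
      have "closure (K \<inter> U j) \<subseteq> K"
        by (rule closure_minimal) (use K(1) compact_imp_closed in auto)
      then have "compact (closure (K \<inter> U j))"
        by (metis K(1) closed_closure compact_Int_closed inf.absorb_iff2)
      then obtain g where "g \<subseteq> A j" "finite g" "closure (K \<inter> U j) \<subseteq> (\<Union>\<alpha>\<in>g. ball (h j \<alpha>) (1 / Suc n))"
        using compactE_image[of _ "A j" "\<lambda>\<alpha>. ball (h j \<alpha>) (1 / Suc n)"] cl by (metis open_ball)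
      then show ?thesis
        using closure_subset[of "K \<inter> U j"] by (intro bexI[of _ g]) (force simp: Fpow_def)+
    qed
    then obtain g where g: "\<And>j n. j \<in> F \<Longrightarrow> g j n \<in> Fpow (A j)"
      "\<And>j n. j \<in> F \<Longrightarrow> K \<inter> U j \<subseteq> (\<Union>\<alpha>\<in>g j n. cball (h j \<alpha>) (1 / Suc n))"
      by metis
    define f where "f n = (\<Union>j\<in>F. g j n)" for n
    have "f n \<in> Fpow (\<Union>j\<in>F. A j)" for n
      using g(1) F(2) unfolding f_def Fpow_def by blast
    then have "f \<in> P" using P(2)[of F f] F unfolding Fpow_def by blast
    moreover have "K \<subseteq> (\<Union>j\<in>F. C f j)"
    proof
      fix x assume x: "x \<in> K"
      then obtain j where j: "j \<in> F" "x \<in> U j" using F(3) by blast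
      have "x \<in> (\<Union>\<alpha>\<in>f n. cball (h j \<alpha>) (1 / Suc n))" for n
        using g(2)[OF j(1), of n] x j unfolding f_def by blast
      then have "x \<in> C f j" using x K(2) unfolding C_def by blast
      then show "x \<in> (\<Union>j\<in>F. C f j)" using j(1) by blast
    qed
    ultimately show "\<exists>p\<in>Fpow J \<times> P. K \<le> (case p of (F, f) \<Rightarrow> \<Union>j\<in>F. C f j)"
      using F by (intro bexI[of _ "(F, f)"]) (auto simp: Fpow_def)
  qed
qed


section \<open>Local density\<close>

lemma Card_order_local_density_at: "x \<in> X \<Longrightarrow> Card_order (local_density_at X x)"
  using local_density_at(1)[of x X] Card_order_dens by auto

lemma local_density_at_witness:
  assumes "x \<in> X"
  obtains N D where "x \<in> top_of_set X interior_of N" "N \<subseteq> X" "N \<subseteq> closure D"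
    "local_density_at X x = dens N" "dens N = |D|"
  using local_density_at(1)[OF assms] dens_witness by (smt (verit) mem_Collect_eq)

lemma nonprecompact_point:
  assumes X: "complete X" and nlc: "\<not> locally_compact_space (top_of_set X)"
  obtains x where "nonprecompact_at X x"
proof -
  have "locally_compact_space (top_of_set X)" if none: "\<And>x. \<not> nonprecompact_at X x"
    unfolding locally_compact_space_def
  proof
    fix x assume "x \<in> topspace (top_of_set X)"
    then have x: "x \<in> X" by simp
    then obtain e where e: "0 < e" "totally_bdd (X \<inter> ball x e)"
      using none[of x] unfolding nonprecompact_at_def by blast
    have "X \<inter> cball x (e/2) \<subseteq> X \<inter> ball x e" using e(1) by auto
    then have "compact (X \<inter> cball x (e/2))"
      using complete_totally_bdd_compact complete_Int_closed[OF X closed_cball]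
        totally_bdd_subset[OF e(2)] by blast
    then show "\<exists>U K. openin (top_of_set X) U \<and> compactin (top_of_set X) K \<and> x \<in> U \<and> U \<subseteq> K"
      using x e(1)
      by (intro exI[of _ "X \<inter> ball x (e/2)"] exI[of _ "X \<inter> cball x (e/2)"])
        (auto simp: compactin_subtopology openin_open_Int)
  qed
  then show thesis using nlc that by blast
qed

lemma nonprecompact_at_imp_infinite:
  assumes "nonprecompact_at X x"
  shows "natLeq \<le>o local_density_at X x"
proof -
  have x: "x \<in> X" using assms unfolding nonprecompact_at_def by blast
  obtain N D where N: "x \<in> top_of_set X interior_of N" "N \<subseteq> closure D"
    "local_density_at X x = dens N" "dens N = |D|"
    using local_density_at_witness[OF x] by metis
  obtain e where e: "0 < e" "X \<inter> ball x e \<subseteq> top_of_set X interior_of N"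
    using neighbourhood_ball[OF N(1)] by blast
  then have "X \<inter> ball x e \<subseteq> closure D"
    using N(2) interior_of_subset[of "top_of_set X" N] by blast
  then have "infinite D"
    using infinite_dense_subset assms e(1) unfolding nonprecompact_at_def by blast
  then show ?thesis using infinite_iff_natLeq_ordLeq N by metis
qed

lemma infinite_local_density:
  assumes "nonprecompact_at X x"
  shows "infinite (Field (local_density X))"
proof -
  have "natLeq \<le>o local_density X"
    using nonprecompact_at_imp_infinite[OF assms] local_density(2)[of x X] assms
      ordLeq_transitive unfolding nonprecompact_at_def by blast
  then have "natLeq \<le>o |Field (local_density X)|"
    using card_of_Field_ordIso[OF local_density(1)] ordIso_symmetric ordLeq_ordIso_trans by blast
  then show ?thesis using infinite_iff_natLeq_ordLeq by blast
qed

lemma nonprecompact_atI: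
  assumes x: "x \<in> X" and "natLeq <o local_density_at X x"
  shows "nonprecompact_at X x"
  unfolding nonprecompact_at_def
proof (intro conjI x allI impI notI)
  fix e :: real assume e: "0 < e" "totally_bdd (X \<inter> ball x e)"
  have "local_density_at X x \<le>o dens (X \<inter> ball x e)"
    using local_density_at(2)[OF x, of "X \<inter> ball x e"] ball_neighbourhood[OF x e(1)] by simp
  then have "local_density_at X x \<le>o natLeq"
    using totally_bdd_dens[OF e(2)] ordLeq_transitive by blast
  then show False using assms(2) not_ordLess_ordLeq by blast
qed

text \<open>
  Cardinals below the local density are exceeded at a point without precompact neighbourhoods:
  infinite ones because the remaining points have countable local density, and finite ones at any
  such point.
\<close>

lemma exceeds_small_cardinal:
  fixes X :: "'a::metric_space set" and B :: "'a set"
  assumes X: "nonprecompact_at X x0" and B: "|B| <o local_density X"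
  obtains x where "nonprecompact_at X x" "|B| <o local_density_at X x"
proof (cases "finite B")
  case True
  then have "|B| <o natLeq" using finite_iff_ordLess_natLeq by blast
  then show thesis
    using that[OF X] nonprecompact_at_imp_infinite[OF X] ordLess_ordLeq_trans by blast
next
  case False
  have "\<exists>x\<in>X. \<not> local_density_at X x \<le>o |B|"
    using local_density(3)[of "|B|" X] B not_ordLess_ordLeq card_of_Card_order by blast
  then obtain x where x: "x \<in> X" "\<not> local_density_at X x \<le>o |B|" by blast
  then have "|B| <o local_density_at X x"
    using Card_order_local_density_at[OF x(1)] card_of_Well_order not_ordLeq_iff_ordLess
      card_order_on_well_order_on by metis
  moreover have "natLeq \<le>o |B|" using False infinite_iff_natLeq_ordLeq by blast
  ultimately show thesis using that nonprecompact_atI[OF x(1)] ordLeq_ordLess_trans by blast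
qed

text \<open>
  The local density does not exceed its value at \<open>x\<close> in some ball about \<open>x\<close>. If a ball of the
  base lies in that ball and contains \<open>x\<close>, the maximum of the local density over it is attained.
  This allows one point to be chosen from each ball of the base such that no value is missed.
\<close>

lemma representatives_of_local_density:
  fixes X :: "'a::metric_space set"
  assumes X: "nonprecompact_at X x0"
  obtains y :: "'a \<Rightarrow> 'a" where "\<And>j. nonprecompact_at X (y j)"
    "\<And>x. nonprecompact_at X x \<Longrightarrow>
      \<exists>j\<in>Field (dens X). local_density_at X x \<le>o local_density_at X (y j)"
proof -
  obtain c r where cr: "\<And>x e. x \<in> X \<Longrightarrow> 0 < e \<Longrightarrow>
    \<exists>j\<in>Field (dens X). x \<in> ball (c j) (r j) \<and> cball (c j) (r j) \<subseteq> ball x e"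
    using ball_base_indexed_by_dens[OF nonprecompact_at_not_totally_bdd[OF X]] by metis
  define B where "B j = {z \<in> ball (c j) (r j). nonprecompact_at X z}" for j
  define maximal where "maximal j z \<longleftrightarrow> z \<in> B j \<and>
    (\<forall>x\<in>B j. local_density_at X x \<le>o local_density_at X z)" for j z
  define y where "y j = (if \<exists>z. maximal j z then SOME z. maximal j z else x0)" for j
  have y: "maximal j (y j)" if "maximal j z" for j z
    using that unfolding y_def by (metis someI_ex)
  have "nonprecompact_at X (y j)" for j
  proof (cases "\<exists>z. maximal j z")
    case True then show ?thesis using y unfolding maximal_def B_def by blast
  next
    case False
    then have "y j = x0" unfolding y_def by meson
    then show ?thesis using X by simp
  qed
  moreover have "\<exists>j\<in>Field (dens X). local_density_at X x \<le>o local_density_at X (y j)"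
    if x: "nonprecompact_at X x" for x
  proof -
    have xX: "x \<in> X" using x unfolding nonprecompact_at_def by blast
    obtain N where N: "x \<in> top_of_set X interior_of N" "N \<subseteq> X" "local_density_at X x = dens N"
      using local_density_at_witness[OF xX] by metis
    obtain e where e: "0 < e" "X \<inter> ball x e \<subseteq> top_of_set X interior_of N"
      using neighbourhood_ball[OF N(1)] by blast
    obtain j where j: "j \<in> Field (dens X)" "x \<in> ball (c j) (r j)" "cball (c j) (r j) \<subseteq> ball x e"
      using cr[OF xX e(1)] by blast
    have "local_density_at X z \<le>o local_density_at X x" if z: "z \<in> B j" for z
    proof -
      have zX: "z \<in> X" using z unfolding B_def nonprecompact_at_def by blast
      have "z \<in> cball (c j) (r j)" using z unfolding B_def by auto
      then have "z \<in> top_of_set X interior_of N" using e(2) j(3) zX by blast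
      then show ?thesis using local_density_at(2)[OF zX N(2)] N(3) by simp
    qed
    then have "maximal j x" using x j(2) unfolding maximal_def B_def by blast
    then have "maximal j (y j)" "x \<in> B j" using y by (auto simp: maximal_def)
    then show ?thesis using j(1) unfolding maximal_def by blast
  qed
  ultimately show thesis using that by blast
qed

section \<open>The local density as an index set\<close>

lemma underS_linear:
  assumes "Well_order r" "a \<in> Field r" "b \<in> Field r"
  shows "underS r a \<subseteq> underS r b \<or> underS r b \<subseteq> underS r a"
proof -
  have lin: "Linear_order r" using assms(1) unfolding well_order_on_def by blast
  show ?thesis
  proof (cases "a = b")
    case False
    then have "(a, b) \<in> r \<or> (b, a) \<in> r"
      using lin assms(2,3) unfolding linear_order_on_def total_on_def by blast
    then show ?thesis using underS_incl_iff[OF lin] assms(2,3) by blast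
  qed simp
qed

lemma underS_bound:
  assumes r: "Well_order r" "Field r \<noteq> {}" and "finite F" "F \<subseteq> Field r"
  shows "\<exists>m\<in>Field r. (\<Union>a\<in>F. underS r a) \<subseteq> underS r m"
  using assms(3,4)
proof (induction F)
  case empty then show ?case using r(2) by auto
next
  case (insert b F)
  then obtain m where m: "m \<in> Field r" "(\<Union>a\<in>F. underS r a) \<subseteq> underS r m" by auto
  have "underS r b \<subseteq> underS r m \<or> underS r m \<subseteq> underS r b"
    using underS_linear[OF r(1), of b m] m(1) insert.prems by auto
  then show ?case using m insert.prems by auto
qed

text \<open>
  This turns a local density that does not attain the supremum into the cardinality of an initial
  segment, the index set of a family of bounded sequences.
\<close>

lemma ordLess_imp_underS:
  fixes r :: "'b rel" and s :: "'c rel"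
  assumes "Card_order r" "Card_order s" "s <o r"
  obtains a where "a \<in> Field r" "|underS r a| =o s"
proof -
  have wo: "Well_order r" "Well_order s" using assms by (auto simp: card_order_on_well_order_on)
  then obtain a where a: "a \<in> Field r" "s =o Restr r (underS r a)"
    using assms(3) ordLess_iff_ordIso_Restr by blast
  have "Field (Restr r (underS r a)) = underS r a"
    using Field_Restr_ofilter[OF wo(1)] wo_rel.underS_ofilter[of r a] wo(1)
    unfolding wo_rel_def by blast
  moreover have "Card_order (Restr r (underS r a))"
    using Card_order_ordIso2[OF assms(2) a(2)] .
  ultimately have "|underS r a| =o Restr r (underS r a)" using card_of_Field_ordIso by metis
  then show thesis using that a ordIso_symmetric ordIso_transitive by blast
qed

text \<open>
  If the local density is not attained, no single point serves for all bounded families of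
  sequences: the larger the bound, the larger the local density of the point has to be. A compact
  set therefore selects finitely many of the representatives by means of a cofinal map onto the
  finite subsets of the density, and it is recorded at each of them. The union of these finitely
  many records is bounded because each local density is smaller than the supremum.
\<close>

lemma compact_subsets_below_Bdd:
  fixes X :: "'a::metric_space set"
  assumes x0: "nonprecompact_at X x0" and nr: "\<not> local_density_realized X"
  shows "compact_subsets X \<preceq>\<^sub>c Bdd_Fin_seqs (local_density X)"
proof -
  let ?l = "local_density X"
  have l: "Card_order ?l" "Well_order ?l" "Field ?l \<noteq> {}"
    using local_density(1)[of X] infinite_local_density[OF x0] by (auto simp: card_order_on_well_order_on)
  have less: "local_density_at X x <o ?l" if "x \<in> X" for x
    using local_density(2)[OF that] nr that ordLeq_iff_ordLess_or_ordIso
    unfolding local_density_realized_def by blast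
  obtain y :: "'a \<Rightarrow> 'a" where y: "\<And>j. nonprecompact_at X (y j)"
    "\<And>x. nonprecompact_at X x \<Longrightarrow>
      \<exists>j\<in>Field (dens X). local_density_at X x \<le>o local_density_at X (y j)"
    using representatives_of_local_density[OF x0] by metis
  have yX: "y j \<in> X" for j using y(1) unfolding nonprecompact_at_def by blast
  have "\<exists>a\<in>Field ?l. |underS ?l a| =o local_density_at X (y j)" for j
    using ordLess_imp_underS[OF l(1) Card_order_local_density_at[OF yX] less[OF yX]] by metis
  then obtain a where a: "\<And>j. a j \<in> Field ?l"
    "\<And>j. |underS ?l (a j)| =o local_density_at X (y j)"
    by metis
  define Q where "Q j = {f :: nat \<Rightarrow> 'a set. \<forall>n. f n \<in> Fpow (underS ?l (a j))}" for j
  have "compact_subsets X \<preceq>\<^sub>c Q j" for j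
    unfolding Q_def using compact_subsets_below_sequences[OF y(1)] ordIso_imp_ordLeq[OF a(2)] by blast
  then have "\<forall>j. \<exists>\<psi>. \<psi> ` compact_subsets X \<subseteq> Q j \<and> mono_on (compact_subsets X) \<psi> \<and>
      (\<forall>f\<in>Q j. \<exists>K\<in>compact_subsets X. f \<le> \<psi> K)"
    unfolding cofinal_below_def by (rule allI)
  from choice[OF this] obtain \<Psi> where *: "\<forall>j. \<Psi> j ` compact_subsets X \<subseteq> Q j \<and>
      mono_on (compact_subsets X) (\<Psi> j) \<and> (\<forall>f\<in>Q j. \<exists>K\<in>compact_subsets X. f \<le> \<Psi> j K)" ..
  have \<Psi>: "\<Psi> j ` compact_subsets X \<subseteq> Q j" "mono_on (compact_subsets X) (\<Psi> j)"
    "\<forall>f\<in>Q j. \<exists>K\<in>compact_subsets X. f \<le> \<Psi> j K" for j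
    using *[rule_format, of j] by simp_all
  have "|Field (dens X)| \<le>o dens X"
    using card_of_Field_ordIso[OF Card_order_dens] ordIso_imp_ordLeq by blast
  then have "compact_subsets X \<preceq>\<^sub>c Fpow (Field (dens X))"
    using compact_subsets_below_Fpow nonprecompact_at_not_totally_bdd[OF x0] by blast
  then obtain \<Phi> where \<Phi>: "\<Phi> ` compact_subsets X \<subseteq> Fpow (Field (dens X))"
    "mono_on (compact_subsets X) \<Phi>"
    "\<forall>g\<in>Fpow (Field (dens X)). \<exists>K\<in>compact_subsets X. g \<subseteq> \<Phi> K"
    unfolding cofinal_below_def by blast
  show ?thesis
  proof (rule cofinal_belowI[where \<psi> = "\<lambda>K n. \<Union>j\<in>\<Phi> K. \<Psi> j K n"])
    fix K assume K: "K \<in> compact_subsets X"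
    have fin: "finite (\<Phi> K)" using \<Phi>(1) K unfolding Fpow_def by blast
    obtain m where m: "m \<in> Field ?l" "(\<Union>b\<in>a ` \<Phi> K. underS ?l b) \<subseteq> underS ?l m"
      using underS_bound[OF l(2,3), of "a ` \<Phi> K"] fin a(1) by blast
    have "\<Psi> j K n \<in> Fpow (underS ?l (a j))" for j n
      using \<Psi>(1)[of j] K unfolding Q_def by blast
    then have "(\<Union>j\<in>\<Phi> K. \<Psi> j K n) \<in> Fpow (underS ?l m)" for n
      using m(2) fin unfolding Fpow_def by blast
    then show "(\<lambda>n. \<Union>j\<in>\<Phi> K. \<Psi> j K n) \<in> Bdd_Fin_seqs ?l"
      using m(1) unfolding Bdd_Fin_seqs_def by blast
  next
    fix K L assume KL: "K \<in> compact_subsets X" "L \<in> compact_subsets X" "K \<le> L"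
    then have "\<Phi> K \<subseteq> \<Phi> L" "\<And>j. \<Psi> j K \<le> \<Psi> j L"
      using mono_onD[OF \<Phi>(2)] mono_onD[OF \<Psi>(2)] by auto
    then show "(\<lambda>n. \<Union>j\<in>\<Phi> K. \<Psi> j K n) \<le> (\<lambda>n. \<Union>j\<in>\<Phi> L. \<Psi> j L n)"
      unfolding le_fun_def by blast
  next
    fix f assume "f \<in> Bdd_Fin_seqs ?l"
    then obtain b where b: "b \<in> Field ?l" "\<And>n. f n \<in> Fpow (underS ?l b)"
      unfolding Bdd_Fin_seqs_def by blast
    obtain x where x: "nonprecompact_at X x" "|underS ?l b| <o local_density_at X x"
      using exceeds_small_cardinal[OF x0 card_of_underS[OF l(1) b(1)]] by blast
    obtain j where j: "j \<in> Field (dens X)" "local_density_at X x \<le>o local_density_at X (y j)"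
      using y(2)[OF x(1)] by blast
    have "|underS ?l b| <o |underS ?l (a j)|"
      using x(2) j(2) a(2) ordIso_symmetric ordLess_ordLeq_trans ordLess_ordIso_trans by blast
    then have "\<not> underS ?l (a j) \<subseteq> underS ?l b"
      using card_of_mono1 not_ordLess_ordLeq by blast
    then have "underS ?l b \<subseteq> underS ?l (a j)"
      using underS_linear[OF l(2) b(1) a(1)] by blast
    then have "f \<in> Q j" using b(2) unfolding Q_def Fpow_def by blast
    then obtain K where K: "K \<in> compact_subsets X" "f \<le> \<Psi> j K" using \<Psi>(3)[of j] by blast
    obtain L where L: "L \<in> compact_subsets X" "{j} \<subseteq> \<Phi> L"
      using \<Phi>(3) j(1) unfolding Fpow_def by blast
    obtain M where M: "M \<in> compact_subsets X" "K \<subseteq> M" "L \<subseteq> M"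
      using compact_subsets_directed[OF K(1) L(1)] by blast
    have "j \<in> \<Phi> M" "f \<le> \<Psi> j M"
      using K L M mono_onD[OF \<Phi>(2) L(1) M(1)] mono_onD[OF \<Psi>(2) K(1) M(1), of j] by auto
    then have "f \<le> (\<lambda>n. \<Union>j\<in>\<Phi> M. \<Psi> j M n)" unfolding le_fun_def by blast
    then show "\<exists>K\<in>compact_subsets X. f \<le> (\<lambda>n. \<Union>j\<in>\<Phi> K. \<Psi> j K n)" using M(1) by blast
  qed
qed

text \<open>
  One point carries the whole record. A point that realizes an uncountable local density has no
  precompact neighbourhood; for a countable local density every point without precompact
  neighbourhoods realizes it.
\<close>

lemma compact_subsets_below_Fin_seqs:
  fixes X :: "'a::metric_space set"
  assumes x0: "nonprecompact_at X x0" and "local_density_realized X"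
  shows "compact_subsets X \<preceq>\<^sub>c Fin_seqs (local_density X)"
proof -
  have "\<exists>x. nonprecompact_at X x \<and> local_density X \<le>o local_density_at X x"
  proof (cases "natLeq <o local_density X")
    case True
    obtain x where x: "x \<in> X" "local_density_at X x =o local_density X"
      using assms(2) unfolding local_density_realized_def by blast
    then have "natLeq <o local_density_at X x"
      using True ordIso_symmetric ordLess_ordIso_trans by blast
    then show ?thesis
      using nonprecompact_atI[OF x(1)] x(2) ordIso_symmetric ordIso_imp_ordLeq by blast
  next
    case False
    then have "local_density X \<le>o natLeq"
      using local_density(1)[of X] natLeq_Well_order not_ordLess_iff_ordLeq
        card_order_on_well_order_on by blast
    then show ?thesis
      using x0 nonprecompact_at_imp_infinite[OF x0] ordLeq_transitive by blast
  qed
  then obtain x where x: "nonprecompact_at X x" "local_density X \<le>o local_density_at X x"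
    by blast
  have "|Field (local_density X)| \<le>o local_density_at X x"
    using card_of_Field_ordIso[OF local_density(1)] x(2) ordIso_ordLeq_trans by blast
  then show ?thesis
    using compact_subsets_below_sequences[OF x(1), of "Field (local_density X)"]
    by (simp add: Fin_seqs_def Fin_def)
qed

text \<open>
  The nets that build compact sets are taken in a ball of the base whose part in \<open>X\<close> is contained
  in the closure of a set indexed by an admissible \<open>B\<close>; the balls without this property are
  replaced by the empty set.
\<close>

lemma Fin_Times_sequences_below:
  fixes X :: "'a::metric_space set" and \<B> :: "'b set set"
  assumes X: "complete X" "\<not> totally_bdd X"
    and \<B>: "\<And>x. x \<in> X \<Longrightarrow> \<exists>B\<in>\<B>. local_density_at X x \<le>o |B|"
    and P: "\<And>f n. f \<in> P \<Longrightarrow> finite (f n)"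
      "\<And>\<F> (f :: nat \<Rightarrow> 'b set). finite \<F> \<Longrightarrow> \<F> \<subseteq> \<B> \<Longrightarrow> (\<And>n. f n \<in> Fpow (\<Union>\<F>)) \<Longrightarrow> f \<in> P"
  shows "Fin (dens X) \<times> P \<preceq>\<^sub>c compact_subsets X"
proof -
  obtain c r where cr: "\<And>x e. x \<in> X \<Longrightarrow> 0 < e \<Longrightarrow>
    \<exists>j\<in>Field (dens X). x \<in> ball (c j) (r j) \<and> cball (c j) (r j) \<subseteq> ball x e"
    using ball_base_indexed_by_dens[OF X(2)] by metis
  define good where "good j B h \<longleftrightarrow> B \<in> \<B> \<and> X \<inter> ball (c j) (r j) \<subseteq> closure (h ` B)"
    for j :: 'a and B :: "'b set" and h :: "'b \<Rightarrow> 'a"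
  define J where "J = {j. \<exists>B h. good j B h}"
  define A where "A j = (SOME B. \<exists>h. good j B h)" for j
  define h where "h j = (SOME h. good j (A j) h)" for j
  have Ah: "good j (A j) (h j)" if "j \<in> J" for j
  proof -
    have "\<exists>h. good j (A j) h" using that someI_ex[of "\<lambda>B. \<exists>h. good j B h"] unfolding J_def A_def by blast
    then show ?thesis unfolding h_def by (rule someI_ex)
  qed
  define A' where "A' j = (if j \<in> J then A j else {})" for j
  define U where "U j = (if j \<in> J then ball (c j) (r j) else {})" for j
  have cover: "X \<subseteq> (\<Union>j\<in>Field (dens X). U j)"
  proof
    fix x assume x: "x \<in> X"
    obtain N D where N: "x \<in> top_of_set X interior_of N" "N \<subseteq> closure D"
      "local_density_at X x = dens N" "dens N = |D|"
      using local_density_at_witness[OF x] by metis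
    obtain B where B: "B \<in> \<B>" "|D| \<le>o |B|" using \<B>[OF x] N by metis
    obtain e where e: "0 < e" "X \<inter> ball x e \<subseteq> top_of_set X interior_of N"
      using neighbourhood_ball[OF N(1)] by blast
    then have D: "X \<inter> ball x e \<subseteq> closure D"
      using N(2) interior_of_subset[of "top_of_set X" N] by blast
    then have "D \<noteq> {}" using x e(1) by auto
    then obtain g where g: "g ` B = D" using card_of_ordLeq2 B(2) by metis
    obtain j where j: "j \<in> Field (dens X)" "x \<in> ball (c j) (r j)" "cball (c j) (r j) \<subseteq> ball x e"
      using cr[OF x e(1)] by blast
    have "ball (c j) (r j) \<subseteq> ball x e" using j(3) ball_subset_cball by blast
    then have "good j B g" using B(1) D g unfolding good_def by blast
    then have "j \<in> J" unfolding J_def by blast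
    then show "x \<in> (\<Union>j\<in>Field (dens X). U j)" using j unfolding U_def by auto
  qed
  have "Fpow (Field (dens X)) \<times> P \<preceq>\<^sub>c compact_subsets X"
  proof (rule sequences_below_compact_subsets[OF X(1) _ cover, where A = A' and h = h])
    show "open (U j)" for j unfolding U_def by simp
    show "X \<inter> U j \<subseteq> closure (h j ` A' j)" for j
      using Ah[of j] unfolding U_def A'_def good_def by auto
    show "f \<in> P" if F: "F \<in> Fpow (Field (dens X))" and f: "\<And>n. f n \<in> Fpow (\<Union>j\<in>F. A' j)" for F f
    proof (rule P(2))
      show "finite (A ` (F \<inter> J))" using F unfolding Fpow_def by auto
      show "A ` (F \<inter> J) \<subseteq> \<B>" using Ah unfolding good_def by blast
      have "(\<Union>j\<in>F. A' j) = \<Union> (A ` (F \<inter> J))" unfolding A'_def by auto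
      then show "f n \<in> Fpow (\<Union> (A ` (F \<inter> J)))" for n using f by simp
    qed
  qed (use P(1) in blast)
  then show ?thesis by (simp add: Fin_def)
qed

text \<open>A countable set is bounded in a cardinal of uncountable cofinality.\<close>

lemma Bdd_Fin_seqs_eq_Fin_seqs:
  assumes r: "Card_order r" "infinite (Field r)" and cof: "uncountable_cofinality r"
  shows "Bdd_Fin_seqs r = Fin_seqs r"
proof
  show "Bdd_Fin_seqs r \<subseteq> Fin_seqs r"
    using underS_Field unfolding Bdd_Fin_seqs_def Fin_seqs_def Fin_def Fpow_def by fastforce
  show "Fin_seqs r \<subseteq> Bdd_Fin_seqs r"
  proof
    fix f assume f: "f \<in> Fin_seqs r"
    define A where "A = (\<Union>n. f n)"
    have fn: "finite (f n)" "f n \<subseteq> Field r" for n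
      using f unfolding Fin_seqs_def Fin_def Fpow_def by auto
    have "countable A" unfolding A_def using fn(1) by (simp add: countable_finite)
    then have "|A| \<le>o natLeq" using countable_card_le_natLeq by blast
    then have "|A| <o cofinality r"
      using cof ordLeq_ordLess_trans unfolding uncountable_cofinality_def by blast
    moreover have "A \<subseteq> Field r" using fn(2) unfolding A_def by blast
    ultimately have "\<not> cofinal A r" using cofinality(2)[OF r] not_ordLess_ordLeq by blast
    then obtain a where a: "a \<in> Field r" "\<And>b. b \<in> A \<Longrightarrow> a = b \<or> (a, b) \<notin> r"
      unfolding cofinal_def by blast
    \<comment> \<open>\<open>a\<close> itself may belong to \<open>A\<close>, so the strict bound is a later element.\<close>
    obtain b where b: "b \<in> Field r" "a \<noteq> b" "(a, b) \<in> r"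
      using infinite_Card_order_limit[OF r a(1)] by blast
    have lin: "Linear_order r" using r(1) unfolding card_order_on_def well_order_on_def by blast
    have "x \<in> underS r b" if x: "x \<in> A" for x
    proof (cases "x = a")
      case True then show ?thesis using b unfolding underS_def by blast
    next
      case False
      then have "(x, a) \<in> r"
        using a x \<open>A \<subseteq> Field r\<close> lin unfolding linear_order_on_def total_on_def by blast
      then have "x \<in> underS r a" using False unfolding underS_def by blast
      then show ?thesis using underS_incl_iff[OF lin a(1) b(1)] b(3) by blast
    qed
    then have "f n \<in> Fpow (underS r b)" for n using fn(1)[of n] unfolding A_def Fpow_def by blast
    then show "f \<in> Bdd_Fin_seqs r" using b(1) unfolding Bdd_Fin_seqs_def by blast
  qed
qed

lemma Fin_Times_Fin_seqs_below:
  fixes X :: "'a::metric_space set"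
  assumes "complete X" "\<not> totally_bdd X"
  shows "Fin (dens X) \<times> Fin_seqs (local_density X) \<preceq>\<^sub>c compact_subsets X"
proof (rule Fin_Times_sequences_below[OF assms, where \<B> = "{Field (local_density X)}"])
  show "\<exists>B\<in>{Field (local_density X)}. local_density_at X x \<le>o |B|" if "x \<in> X" for x
    using local_density(2)[OF that] card_of_Field_ordIso[OF local_density(1)[of X]]
      ordIso_symmetric ordLeq_ordIso_trans by blast
qed (auto simp: Fin_seqs_def Fin_def Fpow_def; blast)+

lemma Fin_Times_Bdd_below:
  fixes X :: "'a::metric_space set"
  assumes X: "complete X" and x0: "nonprecompact_at X x0"
    and nr: "\<not> local_density_realized X"
  shows "Fin (dens X) \<times> Bdd_Fin_seqs (local_density X) \<preceq>\<^sub>c compact_subsets X"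
proof (rule Fin_Times_sequences_below[OF X nonprecompact_at_not_totally_bdd[OF x0],
      where \<B> = "underS (local_density X) ` Field (local_density X)"])
  let ?l = "local_density X"
  have l: "Card_order ?l" "Well_order ?l" "Field ?l \<noteq> {}"
    using local_density(1)[of X] infinite_local_density[OF x0] by (auto simp: card_order_on_well_order_on)
  show "\<exists>B\<in>underS ?l ` Field ?l. local_density_at X x \<le>o |B|" if x: "x \<in> X" for x
  proof -
    have "local_density_at X x <o ?l"
      using local_density(2)[OF x] nr x ordLeq_iff_ordLess_or_ordIso
      unfolding local_density_realized_def by blast
    then obtain a where "a \<in> Field ?l" "|underS ?l a| =o local_density_at X x"
      using ordLess_imp_underS[OF l(1) Card_order_local_density_at[OF x]] by metis
    then show ?thesis using ordIso_symmetric ordIso_imp_ordLeq by blast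
  qed
  show "finite (f n)" if "f \<in> Bdd_Fin_seqs ?l" for f n
    using that unfolding Bdd_Fin_seqs_def Fpow_def by blast
  show "f \<in> Bdd_Fin_seqs ?l"
    if \<F>: "finite \<F>" "\<F> \<subseteq> underS ?l ` Field ?l" and f: "\<And>n. f n \<in> Fpow (\<Union>\<F>)"
    for \<F> and f :: "nat \<Rightarrow> 'a set"
  proof -
    obtain F where F: "finite F" "F \<subseteq> Field ?l" "\<F> = underS ?l ` F"
      using finite_subset_image[OF \<F>] by blast
    obtain m where "m \<in> Field ?l" "(\<Union>a\<in>F. underS ?l a) \<subseteq> underS ?l m"
      using underS_bound[OF l(2,3) F(1,2)] by blast
    then show ?thesis using f unfolding F(3) Bdd_Fin_seqs_def Fpow_def by blast
  qed
qed


section \<open>The cofinal type of the compact subsets\<close>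

theorem theorem3p2:
  fixes X :: "'a::metric_space set"
  assumes "complete X"
  shows
    "(\<not> compact X \<and> locally_compact_space (top_of_set X) \<longrightarrow>
        compact_subsets X \<approx>\<^sub>c Fin (dens X)) \<and>
     (\<not> locally_compact_space (top_of_set X) \<longrightarrow>
        (\<not> local_density_realized X \<longrightarrow>
           compact_subsets X \<approx>\<^sub>c Fin (dens X) \<times> Bdd_Fin_seqs (local_density X)) \<and>
        (local_density_realized X \<or> uncountable_cofinality (local_density X) \<longrightarrow>
           compact_subsets X \<approx>\<^sub>c Fin (dens X) \<times> Fin_seqs (local_density X)))"
proof -
  have Fin: "compact_subsets X \<preceq>\<^sub>c Fin (dens X)" if "\<not> totally_bdd X"
    unfolding Fin_def using compact_subsets_below_Fpow[OF that]
      ordIso_imp_ordLeq[OF card_of_Field_ordIso[OF Card_order_dens]] by blast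
  have 1: "compact_subsets X \<approx>\<^sub>c Fin (dens X)"
    if "\<not> compact X" "locally_compact_space (top_of_set X)"
  proof -
    have "\<not> totally_bdd X" using complete_totally_bdd_compact assms that(1) by blast
    then show ?thesis
      using Fin Fin_below_compact_subsets that(2) unfolding cofinally_equivalent_def by blast
  qed
  have 2: "(\<not> local_density_realized X \<longrightarrow>
           compact_subsets X \<approx>\<^sub>c Fin (dens X) \<times> Bdd_Fin_seqs (local_density X)) \<and>
        (local_density_realized X \<or> uncountable_cofinality (local_density X) \<longrightarrow>
           compact_subsets X \<approx>\<^sub>c Fin (dens X) \<times> Fin_seqs (local_density X))"
    if nlc: "\<not> locally_compact_space (top_of_set X)"
  proof -
    obtain x0 where x0: "nonprecompact_at X x0"
      using nonprecompact_point[OF assms nlc] .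
    note ntb = nonprecompact_at_not_totally_bdd[OF x0]
    have pair: "compact_subsets X \<preceq>\<^sub>c Fin (dens X) \<times> Q" if "compact_subsets X \<preceq>\<^sub>c Q"
      for Q :: "(nat \<Rightarrow> 'a set) set"
      using cofinal_below_Times[OF Fin[OF ntb] that compact_subsets_directed] .
    have Bdd: "compact_subsets X \<approx>\<^sub>c Fin (dens X) \<times> Bdd_Fin_seqs (local_density X)"
      if "\<not> local_density_realized X"
      unfolding cofinally_equivalent_def
      using pair[OF compact_subsets_below_Bdd[OF x0 that]] Fin_Times_Bdd_below[OF assms x0 that] ..
    moreover have "compact_subsets X \<approx>\<^sub>c Fin (dens X) \<times> Fin_seqs (local_density X)"
      if "local_density_realized X"
      unfolding cofinally_equivalent_def
      using pair[OF compact_subsets_below_Fin_seqs[OF x0 that]] Fin_Times_Fin_seqs_below[OF assms ntb] ..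
    moreover have "Bdd_Fin_seqs (local_density X) = Fin_seqs (local_density X)"
      if "uncountable_cofinality (local_density X)"
      using Bdd_Fin_seqs_eq_Fin_seqs[OF local_density(1) infinite_local_density[OF x0] that] .
    ultimately show ?thesis by metis
  qed
  show ?thesis using 1 2 by blast
qed

end
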